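(* Let $X\subseteq\mathbb{R}^n$ be a polyhedral set. Let $$\psi(x)=\max_{1\le i\le k_1}\psi_{1i}(x)-\max_{1\le i\le k_2}\psi_{2i}(x),$$ where the functions $\psi_{ji}:\mathbb{R}^n\to\mathbb{R}$ are all quadratic, and consider the following two conditions: (a) each $\psi_{1i}$ is convex for $i=1,\ldots,k_1$ and each $\psi_{2i}$ is concave for $i=1,\ldots,k_2$; (b) each $\psi_{1i}$ is concave for $i=1,\ldots,k_1$, each $\psi_{2i}$ is strictly convex for $i=1,\ldots,k_2$, and the gradients $\{\nabla\psi_{1i}(\bar x)\}_{i\in\mathcal{A}_1(\bar x)}$ are linearly independent for all $\bar x\in\mathcal{D}_{(\psi,X)}$, where $\mathcal{A}_1(\bar x)=\operatorname{argmax}_{1\le i\le k_1}\psi_{1i}(\bar x)$. Then the set $\psi\left(\mathcal{D}_{(\psi,X)}\right)$ is finite under (a), and the set $\mathcal{D}_{(\psi,X)}$ is finite under (b).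
   Context: A polyhedral set is a set of the form $\{x\in\mathbb{R}^n : Ax\le b\}$. A quadratic function is a polynomial of degree at most two. Directional derivative: $\psi'(\bar x;v)=\lim_{\delta\downarrow 0}\frac{\psi(\bar x+\delta v)-\psi(\bar x)}{\delta}$. A point $\bar x\in X$ is a d-stationary point of $\min_{x\in X}\psi(x)$ if $\psi'(\bar x;x-\bar x)\ge 0$ for all $x\in X$; $\mathcal{D}_{(\psi,X)}$ denotes the set of all such points. $\operatorname{argmax}_{1\le i\le k_1}\psi_{1i}(\bar x)$ is the set of indices $i$ attaining the maximum at $\bar x$. *)

theory Defs
  imports "HOL-Analysis.Analysis"
begin

definition quadratic_function :: "(real ^ 'n \<Rightarrow> real) \<Rightarrow> bool" where
  "quadratic_function f \<longleftrightarrow>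
     (\<exists>(Q :: real ^ 'n ^ 'n) b c. \<forall>x. f x = x \<bullet> (Q *v x) + b \<bullet> x + c)"

definition strictly_convex_on :: "'a::real_vector set \<Rightarrow> ('a \<Rightarrow> real) \<Rightarrow> bool" where
  "strictly_convex_on S f \<longleftrightarrow> convex S \<and>
     (\<forall>x\<in>S. \<forall>y\<in>S. \<forall>u>0. \<forall>v>0. x \<noteq> y \<longrightarrow> u + v = 1 \<longrightarrow>
        f (u *\<^sub>R x + v *\<^sub>R y) < u * f x + v * f y)"

definition gradient :: "('a::real_inner \<Rightarrow> real) \<Rightarrow> 'a \<Rightarrow> 'a" where
  "gradient f x = (THE g. GDERIV f x :> g)"

definition has_dir_derivative ::
  "('a::real_normed_vector \<Rightarrow> real) \<Rightarrow> 'a \<Rightarrow> 'a \<Rightarrow> real \<Rightarrow> bool" where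
  "has_dir_derivative f x v d \<longleftrightarrow>
     ((\<lambda>\<delta>. (f (x + \<delta> *\<^sub>R v) - f x) / \<delta>) \<longlongrightarrow> d) (at_right 0)"

text \<open>The limit defining the directional derivative is required to exist (it always does
  for differences of finite maxima of differentiable functions), so that the sign condition
  never refers to an unspecified value.\<close>

definition d_stationary_points ::
  "('a::real_normed_vector \<Rightarrow> real) \<Rightarrow> 'a set \<Rightarrow> 'a set" where
  "d_stationary_points f X =
     {x \<in> X. \<forall>y\<in>X. \<exists>d. has_dir_derivative f x (y - x) d \<and> d \<ge> 0}"

definition argmax_set :: "'i set \<Rightarrow> ('i \<Rightarrow> 'a \<Rightarrow> real) \<Rightarrow> 'a \<Rightarrow> 'i set" where
  "argmax_set I f x = {i \<in> I. \<forall>j\<in>I. f j x \<le> f i x}"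

text \<open>Linear independence of an indexed family: repeated vectors make it dependent, unlike
  linear independence of the set of its values.\<close>

definition independent_family :: "'i set \<Rightarrow> ('i \<Rightarrow> 'a::real_vector) \<Rightarrow> bool" where
  "independent_family I g \<longleftrightarrow> inj_on g I \<and> independent (g ` I)"

end

theory Submission
  imports Defs
begin

text \<open>
  Both parts rest on the fact that \<open>\<psi> = (max\<^sub>i \<psi>1\<^sub>i) - (max\<^sub>j \<psi>2\<^sub>j)\<close> is the minimum over \<open>j\<close> of
  the functions \<open>(max\<^sub>i \<psi>1\<^sub>i) - \<psi>2\<^sub>j\<close>, so that any index \<open>j\<close> that is active at \<open>x\<close> gives a
  majorant of \<open>\<psi>\<close> touching it at \<open>x\<close>; directional derivatives of \<open>\<psi>\<close> at \<open>x\<close> are thus bounded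
  by slopes of this majorant.  Stationary points are sorted into finitely many classes by their
  active indices, and any two points of a class are compared.

  Under (a) the majorant is convex, so a stationary point minimises it over \<open>X\<close>.  Two stationary
  points with a common active \<open>j\<close> minimise the same function and have the same value of \<open>\<psi>\<close>
  (\<open>d_stationary_le_convex_majorant\<close>).

  Under (b) each \<open>h\<^sub>i = \<psi>1\<^sub>i - \<psi>2\<^sub>j\<close> is strictly concave.  Let \<open>x\<close> and \<open>x'\<close> be different
  stationary points with the same active indices \<open>i\<close> and \<open>j\<close> that satisfy the same
  constraints of \<open>X\<close> strictly.  Then the segment from \<open>x'\<close> to \<open>x\<close> can be prolonged a little beyond
  \<open>x\<close> inside \<open>X\<close>.  If \<open>\<psi> x \<le> \<psi> x'\<close>, every active \<open>h\<^sub>i\<close> has \<open>h\<^sub>i x \<le> h\<^sub>i x'\<close>, so by strict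
  concavity it falls at a uniform rate on the prolongation.  There
  \<open>\<psi>\<close> lies below the maximum of the active \<open>h\<^sub>i\<close>, contradicting stationarity at \<open>x\<close>.
  Hence \<open>\<psi> x' < \<psi> x\<close> (\<open>d_stationary_less_of_same_activity\<close>), and exchanging the two points gives
  the opposite inequality, so each class contains at most one point.
\<close>

section \<open>Active indices of a finite maximum\<close>

lemma finite_image_if_determined_by:
  assumes "finite (c ` S)"
    and "\<And>x y. x \<in> S \<Longrightarrow> y \<in> S \<Longrightarrow> c x = c y \<Longrightarrow> f x = f y"
  shows "finite (f ` S)"
proof (rule finite_subset)
  show "f ` S \<subseteq> (\<lambda>k. f (inv_into S c k)) ` c ` S"
  proof
    fix z assume "z \<in> f ` S"
    then obtain x where x: "x \<in> S" "z = f x" by blast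
    have "f x = f (inv_into S c (c x))"
      using x by (intro assms(2)) (auto simp: inv_into_into f_inv_into_f)
    then show "z \<in> (\<lambda>k. f (inv_into S c k)) ` c ` S"
      using x by blast
  qed
qed (use assms(1) in blast)

lemma Max_eq_iff_argmax_set:
  assumes "finite I" "i \<in> I"
  shows "(MAX k\<in>I. f k x) = f i x \<longleftrightarrow> i \<in> argmax_set I f x"
proof -
  have "(MAX k\<in>I. f k x) = f i x \<longleftrightarrow> (\<forall>a\<in>(\<lambda>k. f k x) ` I. a \<le> f i x)"
    using assms by (subst Max_eq_iff) auto
  then show ?thesis
    using assms by (auto simp: argmax_set_def)
qed

lemma Max_eq_if_argmax_set:
  assumes "finite I" "i \<in> argmax_set I f x"
  shows "(MAX k\<in>I. f k x) = f i x"
  using assms Max_eq_iff_argmax_set[of I i f x] by (simp add: argmax_set_def)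

lemma argmax_set_nonempty:
  assumes "finite I" "I \<noteq> {}"
  shows "argmax_set I f x \<noteq> {}"
proof -
  have "(MAX k\<in>I. f k x) \<in> (\<lambda>k. f k x) ` I"
    using assms by (intro Max_in) auto
  then obtain i where i: "i \<in> I" "(MAX k\<in>I. f k x) = f i x"
    by blast
  then have "i \<in> argmax_set I f x"
    using Max_eq_iff_argmax_set[OF assms(1) i(1), of f x] by simp
  then show ?thesis
    by blast
qed

lemma finite_range_argmax_set:
  assumes "finite I"
  shows "finite (argmax_set I f ` S)"
proof (rule finite_subset)
  show "argmax_set I f ` S \<subseteq> Pow I"
    by (auto simp: argmax_set_def)
qed (use assms in blast)

text \<open>By continuity, indices that are inactive at \<open>x\<close> stay strictly below an active one near \<open>x\<close>;
  this is what keeps the inactive functions out of the local estimate of \<open>\<psi>\<close>.\<close>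

lemma eventually_MAX_attained_at_active:
  fixes f :: "'i \<Rightarrow> 'a::t2_space \<Rightarrow> real"
  assumes "finite I" "I \<noteq> {}" and cont: "\<And>i. i \<in> I \<Longrightarrow> isCont (f i) x"
  shows "\<forall>\<^sub>F z in nhds x. \<exists>i\<in>argmax_set I f x. (MAX k\<in>I. f k z) = f i z"
proof -
  obtain a where a: "a \<in> argmax_set I f x"
    using argmax_set_nonempty[OF assms(1,2), of f x] by blast
  then have aI: "a \<in> I"
    by (simp add: argmax_set_def)
  have "\<forall>\<^sub>F z in nhds x. f k z < f a z" if k: "k \<in> I - argmax_set I f x" for k
  proof -
    have "f k x < f a x"
    proof (rule ccontr)
      assume "\<not> f k x < f a x"
      then have "k \<in> argmax_set I f x"
        using a k by (fastforce simp: argmax_set_def)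
      with k show False by blast
    qed
    moreover have "((\<lambda>z. f a z - f k z) \<longlongrightarrow> f a x - f k x) (nhds x)"
      using cont aI k by (intro tendsto_diff) (auto simp: continuous_at tendsto_at_iff_tendsto_nhds)
    ultimately have "\<forall>\<^sub>F z in nhds x. 0 < f a z - f k z"
      by (intro order_tendstoD) auto
    then show ?thesis
      by simp
  qed
  then have "\<forall>\<^sub>F z in nhds x. \<forall>k\<in>I - argmax_set I f x. f k z < f a z"
    using assms(1) by (simp add: eventually_ball_finite)
  then show ?thesis
  proof eventually_elim
    case (elim z)
    obtain i where i: "i \<in> argmax_set I f z"
      using argmax_set_nonempty[OF assms(1,2), of f z] by blast
    then have iI: "i \<in> I" and "f a z \<le> f i z"
      using aI by (auto simp: argmax_set_def)
    with elim have "i \<in> argmax_set I f x"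
      by (meson DiffI not_less)
    then show ?case
      using Max_eq_if_argmax_set[OF assms(1) i] by blast
  qed
qed

section \<open>Convexity\<close>

lemma convex_on_MAX:
  assumes "finite I" "I \<noteq> {}" and "\<And>i. i \<in> I \<Longrightarrow> convex_on S (f i)"
  shows "convex_on S (\<lambda>x. MAX i\<in>I. f i x)"
  unfolding convex_on_def
proof (intro conjI ballI allI impI)
  show "convex S"
    using assms(2,3) convex_on_imp_convex by blast
next
  fix x y and u v :: real
  assume xy: "x \<in> S" "y \<in> S" and uv: "0 \<le> u" "0 \<le> v" "u + v = 1"
  let ?M = "\<lambda>x. MAX i\<in>I. f i x"
  have "f i (u *\<^sub>R x + v *\<^sub>R y) \<le> u * ?M x + v * ?M y" if "i \<in> I" for i
  proof -
    have "f i (u *\<^sub>R x + v *\<^sub>R y) \<le> u * f i x + v * f i y"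
      using assms(3)[OF that] xy uv unfolding convex_on_def by blast
    also have "\<dots> \<le> u * ?M x + v * ?M y"
      using uv that assms(1) by (intro add_mono mult_left_mono Max_ge) auto
    finally show ?thesis .
  qed
  then show "?M (u *\<^sub>R x + v *\<^sub>R y) \<le> u * ?M x + v * ?M y"
    using assms(1,2) by (subst Max_le_iff) auto
qed

lemma strictly_convex_on_imp_convex_on:
  assumes "strictly_convex_on S g"
  shows "convex_on S g"
  unfolding convex_on_def
proof (intro conjI ballI allI impI)
  show "convex S"
    using assms by (simp add: strictly_convex_on_def)
next
  fix x y and u v :: real
  assume xy: "x \<in> S" "y \<in> S" and uv: "0 \<le> u" "0 \<le> v" "u + v = 1"
  show "g (u *\<^sub>R x + v *\<^sub>R y) \<le> u * g x + v * g y"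
  proof (cases "x = y \<or> u = 0 \<or> v = 0")
    case True
    then show ?thesis
      using uv by (elim disjE) (simp_all flip: scaleR_left_distrib distrib_right)
  next
    case False
    then show ?thesis
      using assms xy uv unfolding strictly_convex_on_def by (simp add: less_imp_le)
  qed
qed

text \<open>The point \<open>x\<close> lies between \<open>x - u / 2\<close> and \<open>x + t u\<close>, so the slope of \<open>h\<close> to its right is
  at most the slope on \<open>[x - u / 2, x]\<close>.  The half step leaves room for strictness: for strictly
  concave \<open>h\<close> the value at the midpoint of \<open>[x - u, x]\<close> exceeds the mean of the end values.\<close>

lemma concave_on_prolong_le:
  assumes "concave_on UNIV h" "0 < t"
  shows "h (x + t *\<^sub>R u) - h x \<le> - t * (2 * (h (x - (1/2) *\<^sub>R u) - h x))"
proof -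
  \<comment> \<open>The weight for which \<open>x\<close> is the convex combination of the two outer points.\<close>
  define r where "r = 1 / (1 + 2 * t)"
  have r: "0 \<le> r" "r \<le> 1" "r * (1 + 2 * t) = 1"
    using assms(2) by (auto simp: r_def)
  have "(1 - r) *\<^sub>R (x - s *\<^sub>R u) + r *\<^sub>R (x + t *\<^sub>R u)
      = x + (r * t - (1 - r) * s) *\<^sub>R u" for s
    by (simp add: algebra_simps)
  moreover have "r * t - (1 - r) * (1/2) = 0"
    using r(3) by (simp add: field_simps)
  ultimately have "(1 - r) *\<^sub>R (x - (1/2) *\<^sub>R u) + r *\<^sub>R (x + t *\<^sub>R u) = x"
    by simp
  then have "(1 - r) * h (x - (1/2) *\<^sub>R u) + r * h (x + t *\<^sub>R u) \<le> h x"
    using concave_onD[OF assms(1) r(1,2), of "x - (1/2) *\<^sub>R u" "x + t *\<^sub>R u"] by simp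
  then have "(1 + 2 * t) * ((1 - r) * h (x - (1/2) *\<^sub>R u) + r * h (x + t *\<^sub>R u)) \<le> (1 + 2 * t) * h x"
    using assms(2) by (intro mult_left_mono) auto
  moreover have "(1 + 2 * t) * ((1 - r) * h (x - (1/2) *\<^sub>R u) + r * h (x + t *\<^sub>R u))
      = 2 * t * h (x - (1/2) *\<^sub>R u) + h (x + t *\<^sub>R u)"
  proof -
    have "(1 + 2 * t) * (1 - r) = 2 * t"
      using r(3) by (simp add: algebra_simps)
    moreover have "(1 + 2 * t) * r = 1"
      using r(3) by (simp add: algebra_simps)
    ultimately show ?thesis
      by (simp add: distrib_left flip: mult.assoc)
  qed
  ultimately show ?thesis
    by (simp add: algebra_simps)
qed

section \<open>Prolonging segments inside a polyhedron\<close>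

text \<open>A constraint that is tight at both points stays tight on the whole line through them,
  and one that is slack at \<open>x\<close> tolerates a short step in any direction.\<close>

lemma halfspaces_prolong_segment:
  fixes x x' :: "'a::euclidean_space"
  assumes "finite F" and hs: "\<And>h. h \<in> F \<Longrightarrow> \<exists>a b. a \<noteq> 0 \<and> h = {x. a \<bullet> x \<le> b}"
    and x: "x \<in> \<Inter>F" "x' \<in> \<Inter>F"
    and slack: "{h \<in> F. x \<in> interior h} = {h \<in> F. x' \<in> interior h}"
  shows "\<exists>\<epsilon>>0. x + \<epsilon> *\<^sub>R (x - x') \<in> \<Inter>F"
proof -
  have "\<forall>\<^sub>F \<epsilon> in at_right 0. x + \<epsilon> *\<^sub>R (x - x') \<in> h" if h: "h \<in> F" for h
  proof -
    obtain a b where ab: "a \<noteq> 0" "h = {x. a \<bullet> x \<le> b}"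
      using hs[OF h] by blast
    show ?thesis
    proof (cases "x \<in> interior h")
      case True
      have "((\<lambda>\<epsilon>. x + \<epsilon> *\<^sub>R (x - x')) \<longlongrightarrow> x + 0 *\<^sub>R (x - x')) (at_right 0)"
        by (intro tendsto_intros)
      then have "\<forall>\<^sub>F \<epsilon> in at_right 0. x + \<epsilon> *\<^sub>R (x - x') \<in> interior h"
        using True by (intro topological_tendstoD) auto
      then show ?thesis
        by eventually_elim (use interior_subset in blast)
    next
      case False
      with slack h have "x' \<notin> interior h"
        by blast
      moreover have "x \<in> h" "x' \<in> h"
        using x h by auto
      ultimately have "a \<bullet> x = b" "a \<bullet> x' = b"
        using False ab by auto
      then show ?thesis
        using ab by (simp add: inner_add_right inner_diff_right)
    qed
  qed
  then have "\<forall>\<^sub>F \<epsilon> in at_right 0. \<forall>h\<in>F. x + \<epsilon> *\<^sub>R (x - x') \<in> h"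
    using \<open>finite F\<close> by (simp add: eventually_ball_finite)
  then have "\<forall>\<^sub>F \<epsilon> in at_right (0::real). 0 < \<epsilon> \<and> x + \<epsilon> *\<^sub>R (x - x') \<in> \<Inter>F"
    using eventually_at_right_less[of 0] by eventually_elim auto
  then show ?thesis
    using eventually_happens'[OF trivial_limit_at_right_real] by blast
qed

section \<open>Comparing stationary points\<close>

text \<open>Replaces every computation of a directional derivative: an upper bound on the
  increments of \<open>\<psi>\<close> that is linear near \<open>x\<close> bounds the derivative that stationarity provides.\<close>

lemma d_stationary_slope_nonneg:
  assumes "x \<in> d_stationary_points \<psi> X" "y \<in> X"
    and "eventually (\<lambda>\<delta>. \<psi> (x + \<delta> *\<^sub>R (y - x)) - \<psi> x \<le> \<delta> * s) (at_right 0)"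
  shows "0 \<le> s"
proof -
  obtain d where "has_dir_derivative \<psi> x (y - x) d" "0 \<le> d"
    using assms(1,2) by (auto simp: d_stationary_points_def)
  moreover have "eventually (\<lambda>\<delta>. (\<psi> (x + \<delta> *\<^sub>R (y - x)) - \<psi> x) / \<delta> \<le> s) (at_right 0)"
    using assms(3) eventually_at_right_less[of 0]
    by eventually_elim (simp add: field_simps)
  ultimately have "d \<le> s"
    unfolding has_dir_derivative_def by (intro tendsto_upperbound) auto
  with \<open>0 \<le> d\<close> show ?thesis by linarith
qed

lemma d_stationary_le_convex_majorant:
  assumes x: "x \<in> d_stationary_points \<psi> X" and y: "y \<in> X"
    and conv: "convex_on UNIV \<phi>" and maj: "\<And>z. \<psi> z \<le> \<phi> z" and touch: "\<psi> x = \<phi> x"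
  shows "\<phi> x \<le> \<phi> y"
proof -
  have "eventually (\<lambda>\<delta>. \<psi> (x + \<delta> *\<^sub>R (y - x)) - \<psi> x \<le> \<delta> * (\<phi> y - \<phi> x)) (at_right 0)"
    using eventually_at_right_real[of 0 1, simplified]
  proof eventually_elim
    case (elim \<delta>)
    have "\<psi> (x + \<delta> *\<^sub>R (y - x)) \<le> \<phi> ((1 - \<delta>) *\<^sub>R x + \<delta> *\<^sub>R y)"
      using maj by (simp add: algebra_simps)
    also have "\<dots> \<le> (1 - \<delta>) * \<phi> x + \<delta> * \<phi> y"
      using elim by (intro convex_onD[OF conv]) auto
    finally show ?case
      using touch by (simp add: algebra_simps)
  qed
  from d_stationary_slope_nonneg[OF x y this] show ?thesis
    by simp
qed

text \<open>Moving on from \<open>x'\<close> through \<open>x\<close> is a feasible direction at \<open>x\<close>.  If \<open>\<psi>\<close> did not increase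
  from \<open>x'\<close> to \<open>x\<close>, it would have to decrease beyond \<open>x\<close> at a positive rate.\<close>

lemma d_stationary_less_of_same_activity:
  fixes f :: "'i \<Rightarrow> 'a::euclidean_space \<Rightarrow> real" and g :: "'j \<Rightarrow> 'a \<Rightarrow> real"
  assumes I: "finite I" "I \<noteq> {}" and J: "finite J" "J \<noteq> {}"
    and conc: "\<And>i. i \<in> I \<Longrightarrow> concave_on UNIV (f i)"
    and sconv: "\<And>j. j \<in> J \<Longrightarrow> strictly_convex_on UNIV (g j)"
    and \<psi>: "\<And>x. \<psi> x = (MAX i\<in>I. f i x) - (MAX j\<in>J. g j x)"
    and x: "x \<in> d_stationary_points \<psi> X"
    and prolong: "0 < \<epsilon>" "x + \<epsilon> *\<^sub>R (x - x') \<in> X"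
    and same: "argmax_set I f x = argmax_set I f x'" "argmax_set J g x = argmax_set J g x'"
    and neq: "x \<noteq> x'"
  shows "\<psi> x' < \<psi> x"
proof (rule ccontr)
  assume "\<not> \<psi> x' < \<psi> x"
  then have le: "\<psi> x \<le> \<psi> x'" by simp
  define A where "A = argmax_set I f x"
  have A: "finite A" "A \<noteq> {}" "A \<subseteq> I"
    using I argmax_set_nonempty[OF I, of f x] by (auto simp: A_def argmax_set_def)
  obtain j where j: "j \<in> argmax_set J g x" and jJ: "j \<in> J"
    using argmax_set_nonempty[OF J, of g x] by (auto simp: argmax_set_def)
  define h where "h i z = f i z - g j z" for i z
  define m where "m = x - (1/2) *\<^sub>R (x - x')"
  \<comment> \<open>Beyond \<open>x\<close> every active \<open>h i\<close> falls at least at the rate \<open>c\<close> along \<open>x - x'\<close>; taking the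
    minimum makes the rate independent of the index attaining the maximum nearby.\<close>
  define c where "c = (MIN i\<in>A. 2 * (h i m - h i x))"

  have conc_h: "concave_on UNIV (h i)" if "i \<in> I" for i
  proof -
    have "convex_on UNIV (\<lambda>z. - f i z + g j z)"
      using conc[OF that] strictly_convex_on_imp_convex_on[OF sconv[OF jJ]]
      by (intro convex_on_add) (simp_all add: concave_on_def)
    then show ?thesis
      by (simp add: concave_on_def h_def)
  qed
  have eq: "\<psi> x = h i x" "\<psi> x' = h i x'" if "i \<in> A" for i
  proof -
    have "i \<in> argmax_set I f x" "i \<in> argmax_set I f x'" "j \<in> argmax_set J g x'"
      using that j same by (auto simp: A_def)
    then show "\<psi> x = h i x" "\<psi> x' = h i x'"
      using j by (simp_all add: \<psi> h_def Max_eq_if_argmax_set[OF I(1)] Max_eq_if_argmax_set[OF J(1)])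
  qed
  have gap: "h i x < h i m" if i: "i \<in> A" for i
  proof -
    have m: "m = (1/2) *\<^sub>R x + (1/2) *\<^sub>R x'"
      using scaleR_half_double[of x] by (simp add: m_def algebra_simps)
    have "f i m \<ge> (1/2) * f i x + (1/2) * f i x'"
      using concave_onD[OF conc, of i "1/2" x x'] i A unfolding m by auto
    moreover have "g j (u *\<^sub>R x + v *\<^sub>R x') < u * g j x + v * g j x'"
      if "0 < u" "0 < v" "u + v = 1" for u v
      using sconv[OF jJ] neq that by (simp add: strictly_convex_on_def)
    from this[of "1/2" "1/2"] have "g j m < (1/2) * g j x + (1/2) * g j x'"
      by (simp add: m)
    ultimately show ?thesis
      using le eq[OF i] by (simp add: h_def)
  qed
  have "0 < c"
    unfolding c_def using A gap by (subst Min_gr_iff) auto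

  have "((\<lambda>\<delta>. x + \<delta> *\<^sub>R (\<epsilon> *\<^sub>R (x - x'))) \<longlongrightarrow> x + 0 *\<^sub>R (\<epsilon> *\<^sub>R (x - x'))) (at_right 0)"
    by (intro tendsto_intros)
  then have lim: "filterlim (\<lambda>\<delta>. x + \<delta> *\<^sub>R (\<epsilon> *\<^sub>R (x - x'))) (nhds x) (at_right 0)"
    by simp
  have "isCont (f i) x" if "i \<in> I" for i
  proof -
    have "continuous_on UNIV (\<lambda>z. - f i z)"
      using conc[OF that] by (intro convex_on_continuous) (simp_all add: concave_on_def)
    then have "continuous_on UNIV (\<lambda>z. - (- f i z))"
      by (rule continuous_on_minus)
    then show ?thesis
      by (simp add: continuous_on_eq_continuous_at)
  qed
  from eventually_compose_filterlim[OF eventually_MAX_attained_at_active[OF I this] lim]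
  have "\<forall>\<^sub>F \<delta> in at_right 0. \<exists>i\<in>A.
      (MAX k\<in>I. f k (x + \<delta> *\<^sub>R (\<epsilon> *\<^sub>R (x - x')))) = f i (x + \<delta> *\<^sub>R (\<epsilon> *\<^sub>R (x - x')))"
    by (simp add: A_def)
  then have "\<forall>\<^sub>F \<delta> in at_right 0.
      \<psi> (x + \<delta> *\<^sub>R ((x + \<epsilon> *\<^sub>R (x - x')) - x)) - \<psi> x \<le> \<delta> * (- \<epsilon> * c)"
    using eventually_at_right_less[of 0]
  proof eventually_elim
    case (elim \<delta>)
    define z where "z = x + (\<delta> * \<epsilon>) *\<^sub>R (x - x')"
    obtain i where i: "i \<in> A" "(MAX k\<in>I. f k z) = f i z"
      using elim by (auto simp: z_def)
    have pos: "0 < \<delta> * \<epsilon>"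
      using elim prolong by simp
    have "g j z \<le> (MAX k\<in>J. g k z)"
      using J jJ by (intro Max_ge) auto
    then have "\<psi> z - \<psi> x \<le> h i z - h i x"
      using i eq by (simp add: \<psi>[of z] h_def)
    also have "\<dots> \<le> - (\<delta> * \<epsilon>) * (2 * (h i m - h i x))"
      unfolding z_def m_def using conc_h[of i] i A pos by (intro concave_on_prolong_le) auto
    also have "\<dots> \<le> - (\<delta> * \<epsilon>) * c"
    proof -
      have "c \<le> 2 * (h i m - h i x)"
        unfolding c_def using A i by (intro Min_le) auto
      then show ?thesis
        using pos by (intro mult_left_mono_neg) auto
    qed
    finally show ?case
      by (simp add: z_def mult.assoc)
  qed
  from d_stationary_slope_nonneg[OF x prolong(2) this] have "0 \<le> - \<epsilon> * c" .
  with \<open>0 < c\<close> prolong(1) show False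
    by (simp add: mult_le_0_iff)
qed

section \<open>Finiteness\<close>

text \<open>The value at a stationary point is the minimum over \<open>X\<close> of one of finitely many convex
  majorants, hence determined by the active indices of the subtracted maximum.\<close>

theorem finite_d_stationary_values_of_convex_minus_concave:
  fixes f :: "'i \<Rightarrow> 'a::real_normed_vector \<Rightarrow> real" and g :: "'j \<Rightarrow> 'a \<Rightarrow> real"
  assumes I: "finite I" "I \<noteq> {}" and J: "finite J" "J \<noteq> {}"
    and conv: "\<And>i. i \<in> I \<Longrightarrow> convex_on UNIV (f i)"
    and conc: "\<And>j. j \<in> J \<Longrightarrow> concave_on UNIV (g j)"
    and \<psi>: "\<And>x. \<psi> x = (MAX i\<in>I. f i x) - (MAX j\<in>J. g j x)"
  shows "finite (\<psi> ` d_stationary_points \<psi> X)"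
proof (rule finite_image_if_determined_by)
  show "finite (argmax_set J g ` d_stationary_points \<psi> X)"
    using J(1) by (rule finite_range_argmax_set)
next
  have le: "\<psi> x \<le> \<psi> y"
    if x: "x \<in> d_stationary_points \<psi> X" and y: "y \<in> d_stationary_points \<psi> X"
      and same: "argmax_set J g x = argmax_set J g y" for x y
  proof -
    obtain j where j: "j \<in> argmax_set J g x" and jJ: "j \<in> J"
      using argmax_set_nonempty[OF J, of g x] by (auto simp: argmax_set_def)
    define \<phi> where "\<phi> z = (MAX i\<in>I. f i z) - g j z" for z
    have touch: "\<psi> x = \<phi> x" "\<psi> y = \<phi> y"
      using j same by (simp_all add: \<psi> \<phi>_def Max_eq_if_argmax_set[OF J(1)])
    have "\<phi> x \<le> \<phi> y"
    proof (rule d_stationary_le_convex_majorant[of x \<psi> X y \<phi>])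
      show "y \<in> X"
        using y by (simp add: d_stationary_points_def)
      show "convex_on UNIV \<phi>"
        unfolding \<phi>_def using I jJ conv conc by (intro convex_on_diff convex_on_MAX) auto
      show "\<psi> z \<le> \<phi> z" for z
        using J jJ by (simp add: \<psi> \<phi>_def)
    qed (fact x touch(1))+
    then show ?thesis
      using touch by simp
  qed
  show "\<psi> x = \<psi> y"
    if "x \<in> d_stationary_points \<psi> X" "y \<in> d_stationary_points \<psi> X"
      "argmax_set J g x = argmax_set J g y" for x y
    using le[of x y] le[of y x] that by simp
qed

text \<open>The set of constraints that are slack at a point singles out the face of \<open>X\<close> having the
  point in its relative interior.  Together with the two sets of active indices it determines a
  stationary point.\<close>

theorem finite_d_stationary_points_of_concave_minus_strictly_convex:
  fixes f :: "'i \<Rightarrow> 'a::euclidean_space \<Rightarrow> real" and g :: "'j \<Rightarrow> 'a \<Rightarrow> real"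
  assumes X: "polyhedron X"
    and I: "finite I" "I \<noteq> {}" and J: "finite J" "J \<noteq> {}"
    and conc: "\<And>i. i \<in> I \<Longrightarrow> concave_on UNIV (f i)"
    and sconv: "\<And>j. j \<in> J \<Longrightarrow> strictly_convex_on UNIV (g j)"
    and \<psi>: "\<And>x. \<psi> x = (MAX i\<in>I. f i x) - (MAX j\<in>J. g j x)"
  shows "finite (d_stationary_points \<psi> X)"
proof -
  let ?D = "d_stationary_points \<psi> X"
  obtain F where F: "finite F" "X = \<Inter>F" "\<And>h. h \<in> F \<Longrightarrow> \<exists>a b. a \<noteq> 0 \<and> h = {x. a \<bullet> x \<le> b}"
    using X unfolding polyhedron_def by metis
  define slack where "slack x = {h \<in> F. x \<in> interior h}" for x
  have less: "\<psi> y < \<psi> x"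
    if x: "x \<in> ?D" and y: "y \<in> ?D" and neq: "x \<noteq> y" and slack: "slack x = slack y"
      and act: "argmax_set I f x = argmax_set I f y" "argmax_set J g x = argmax_set J g y" for x y
  proof -
    have "x \<in> \<Inter>F" "y \<in> \<Inter>F"
      using x y F(2) by (simp_all add: d_stationary_points_def)
    from halfspaces_prolong_segment[OF F(1,3) this slack[unfolded slack_def]]
    obtain \<epsilon> where "0 < \<epsilon>" "x + \<epsilon> *\<^sub>R (x - y) \<in> X"
      using F(2) by blast
    from d_stationary_less_of_same_activity[OF I J conc sconv \<psi> x this act neq]
    show ?thesis .
  qed
  have "finite (id ` ?D)"
  proof (rule finite_image_if_determined_by)
    show "finite ((\<lambda>x. (slack x, argmax_set I f x, argmax_set J g x)) ` ?D)"
    proof (rule finite_subset)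
      show "(\<lambda>x. (slack x, argmax_set I f x, argmax_set J g x)) ` ?D
          \<subseteq> Pow F \<times> argmax_set I f ` ?D \<times> argmax_set J g ` ?D"
        by (auto simp: slack_def)
      show "finite (Pow F \<times> argmax_set I f ` ?D \<times> argmax_set J g ` ?D)"
        using F(1) I(1) J(1) by (intro finite_cartesian_product finite_range_argmax_set) auto
    qed
    show "id x = id y"
      if "x \<in> ?D" "y \<in> ?D" "(slack x, argmax_set I f x, argmax_set J g x)
        = (slack y, argmax_set I f y, argmax_set J g y)" for x y
      using less[of x y] less[of y x] that by fastforce
  qed
  then show ?thesis
    by simp
qed

theorem proposition9:
  fixes X :: "(real ^ 'n) set"
    and k1 k2 :: nat
    and \<psi>1 \<psi>2 :: "nat \<Rightarrow> real ^ 'n \<Rightarrow> real"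
    and \<psi> :: "real ^ 'n \<Rightarrow> real"
  assumes "polyhedron X"
    and "1 \<le> k1" and "1 \<le> k2"
    and "\<And>i. i \<in> {1..k1} \<Longrightarrow> quadratic_function (\<psi>1 i)"
    and "\<And>i. i \<in> {1..k2} \<Longrightarrow> quadratic_function (\<psi>2 i)"
    and "\<And>x. \<psi> x = (MAX i\<in>{1..k1}. \<psi>1 i x) - (MAX i\<in>{1..k2}. \<psi>2 i x)"
  shows
    "((\<forall>i\<in>{1..k1}. convex_on UNIV (\<psi>1 i)) \<and>
      (\<forall>i\<in>{1..k2}. concave_on UNIV (\<psi>2 i))
      \<longrightarrow> finite (\<psi> ` d_stationary_points \<psi> X))
     \<and>
     ((\<forall>i\<in>{1..k1}. concave_on UNIV (\<psi>1 i)) \<and>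
      (\<forall>i\<in>{1..k2}. strictly_convex_on UNIV (\<psi>2 i)) \<and>
      (\<forall>x\<in>d_stationary_points \<psi> X.
         independent_family (argmax_set {1..k1} \<psi>1 x) (\<lambda>i. gradient (\<psi>1 i) x))
      \<longrightarrow> finite (d_stationary_points \<psi> X))"
proof (intro conjI impI; elim conjE)
  have idx: "finite {1..k1}" "{1..k1} \<noteq> {}" "finite {1..k2}" "{1..k2} \<noteq> {}"
    using assms(2,3) by simp_all
  show "finite (\<psi> ` d_stationary_points \<psi> X)"
    if "\<forall>i\<in>{1..k1}. convex_on UNIV (\<psi>1 i)" "\<forall>i\<in>{1..k2}. concave_on UNIV (\<psi>2 i)"
    using that assms(6)
    by (intro finite_d_stationary_values_of_convex_minus_concave[OF idx, of \<psi>1 \<psi>2]) auto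
  show "finite (d_stationary_points \<psi> X)"
    if "\<forall>i\<in>{1..k1}. concave_on UNIV (\<psi>1 i)" "\<forall>i\<in>{1..k2}. strictly_convex_on UNIV (\<psi>2 i)"
    using that assms(6)
    by (intro finite_d_stationary_points_of_concave_minus_strictly_convex[OF assms(1) idx, of \<psi>1 \<psi>2])
      auto
qed

end
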